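(* Let $n$ be a positive integer with $n \geq 2$. Then $$S_{n-1}(n) - n B_{n-1} \equiv \begin{cases} n/2, & \text{if } n \equiv 2 \pmod 4 \text{ and } n > 2,\\ 0, & \text{otherwise,}\end{cases} \pmod{n}.$$
   Context: The Bernoulli numbers $B_n$ are the rational numbers defined by $\frac{z}{e^z-1} = \sum_{n=0}^\infty B_n \frac{z^n}{n!}$ for $|z|<2\pi$ (so $B_0=1$, $B_1=-\tfrac12$, $B_2=\tfrac16$, $B_4=-\tfrac1{30}$). For positive integers $n,m$, $S_n(m) = \sum_{k=1}^{m-1} k^n$. Congruences between rational numbers are understood as follows: $a \equiv b \pmod n$ means that $a-b$, written in lowest terms, has denominator coprime to $n$ and numerator divisible by $n$. *)

theory Defs
  imports "HOL-Complex_Analysis.Complex_Analysis"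
begin

(* At z = 0 the quotient z / (exp z - 1) denotes its continuous extension 1; in HOL it
   would otherwise be 0 / 0 = 0. *)
definition is_bernoulli_seq :: "(nat \<Rightarrow> rat) \<Rightarrow> bool" where
  "is_bernoulli_seq B \<longleftrightarrow>
     (\<forall>z::complex. norm z < 2 * pi \<longrightarrow>
        (\<lambda>n. of_rat (B n) * z ^ n / fact n) sums (if z = 0 then 1 else z / (exp z - 1)))"

(* The description is proper: see is_bernoulli_seq_ex1 below. *)
definition bernoulli :: "nat \<Rightarrow> rat" where
  "bernoulli = (THE B. is_bernoulli_seq B)"

definition power_sum :: "nat \<Rightarrow> nat \<Rightarrow> nat" where
  "power_sum n m = (\<Sum>k = 1..m - 1. k ^ n)"

(* quotient_of yields numerator and (positive) denominator in lowest terms. *)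
definition rat_cong :: "rat \<Rightarrow> rat \<Rightarrow> nat \<Rightarrow> bool" where
  "rat_cong a b n \<longleftrightarrow>
     (case quotient_of (a - b) of (p, q) \<Rightarrow> coprime q (int n) \<and> int n dvd p)"

lemma is_bernoulli_seq_ex1: "\<exists>!B. is_bernoulli_seq B"
proof -
  define f :: "complex \<Rightarrow> complex" where "f = (\<lambda>z. if z = 0 then 1 else z / (exp z - 1))"
  define h :: "complex \<Rightarrow> complex" where "h = (\<lambda>z. if z = 0 then 1 else (exp z - 1) / z)"
  define G :: "rat fps" where "G = Abs_fps (\<lambda>n. 1 / fact (Suc n))"
  define H :: "complex fps" where "H = Abs_fps (\<lambda>n. 1 / fact (Suc n))"
  define F :: "complex fps" where "F = Abs_fps (\<lambda>n. of_rat (fps_nth (inverse G) n))"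
  have f_eq: "f = (\<lambda>z. inverse (h z))"
    by (auto simp: f_def h_def fun_eq_iff)
  have "(\<lambda>z::complex. if z = 0 then 1 else (exp z - 1) / z ^ 1)
          has_fps_expansion fps_shift 1 (fps_exp 1 - 1)"
    by (intro has_fps_expansion_shift has_fps_expansion_diff has_fps_expansion_exp1
          has_fps_expansion_1 subdegree_geI) (auto simp: fps_eq_iff intro!: exI[of _ 1])
  also have "fps_shift 1 (fps_exp 1 - 1) = H"
    by (simp add: fps_eq_iff H_def algebra_simps)
  finally have h: "h has_fps_expansion H"
    unfolding h_def power_one_right .
  have of_rat_fact: "of_rat (fact n) = (fact n :: complex)" for n
    by (metis of_nat_fact of_rat_of_nat_eq)
  have "G * inverse G = 1"
    by (intro inverse_mult_eq_1') (simp add: G_def)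
  have "H * F = 1"
  proof (rule fps_ext)
    fix n
    have "of_rat (fps_nth G k) = fps_nth H k" for k
      by (simp add: G_def H_def of_rat_divide of_rat_fact del: fact_Suc)
    hence "fps_nth (H * F) n = of_rat (fps_nth (G * inverse G) n)"
      unfolding fps_mult_nth of_rat_sum of_rat_mult F_def by simp
    also have "\<dots> = fps_nth 1 n"
      unfolding \<open>G * inverse G = 1\<close> by simp
    finally show "fps_nth (H * F) n = fps_nth 1 n" .
  qed
  hence "inverse H = F"
    by (simp add: fps_inverse_unique)
  moreover have "(\<lambda>z. inverse (h z)) has_fps_expansion inverse H"
    using h by (rule has_fps_expansion_inverse) (simp add: H_def)
  ultimately have f: "f has_fps_expansion F"
    by (simp add: f_eq)
  have nz: "h z \<noteq> 0" if "norm z < 2 * pi" for z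
  proof
    assume "h z = 0"
    hence "z \<noteq> 0" "exp z = 1"
      by (auto simp: h_def split: if_splits)
    then obtain k :: int where k: "Re z = 0" "Im z = of_int (2 * k) * pi"
      by (auto simp: exp_eq_1)
    have "k \<noteq> 0"
      using k \<open>z \<noteq> 0\<close> by (auto simp: complex_eq_iff)
    have "norm z = 2 * pi * of_int \<bar>k\<bar>"
      using k by (simp add: cmod_def abs_mult)
    moreover have "of_int \<bar>k\<bar> \<ge> (1::real)"
      using \<open>k \<noteq> 0\<close> by linarith
    ultimately have "norm z \<ge> 2 * pi"
      by simp
    thus False
      using that by simp
  qed
  have "h holomorphic_on UNIV"
  proof -
    have "(\<lambda>z. if z = 0 then deriv exp 0 else (exp z - exp 0) / (z - 0 :: complex))
            holomorphic_on UNIV"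
      by (intro pole_lemma_open holomorphic_intros open_UNIV)
    moreover have "deriv exp (0::complex) = 1"
      by (intro DERIV_imp_deriv) (auto intro!: derivative_eq_intros)
    ultimately show ?thesis
      by (simp add: h_def cong: if_cong)
  qed
  hence holo: "f holomorphic_on eball 0 (2 * pi)"
    unfolding f_eq using nz by (intro holomorphic_intros) (auto intro: holomorphic_on_subset)
  have ex: "is_bernoulli_seq (\<lambda>n. fact n * fps_nth (inverse G) n)"
    unfolding is_bernoulli_seq_def
  proof (intro allI impI)
    fix z :: complex
    assume "norm z < 2 * pi"
    hence "(\<lambda>n. fps_nth F n * z ^ n) sums f z"
      by (intro has_fps_expansion_imp_sums_complex[OF f holo]) simp
    thus "(\<lambda>n. of_rat (fact n * fps_nth (inverse G) n) * z ^ n / fact n) sums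
        (if z = 0 then 1 else z / (exp z - 1))"
      by (simp add: F_def f_def of_rat_mult of_rat_fact)
  qed
  have uniq: "of_rat (B n) / fact n = fps_nth F n" if "is_bernoulli_seq B" for B n
  proof -
    have "eventually (\<lambda>z::complex. z \<in> ball 0 (2 * pi)) (nhds 0)"
      by (intro eventually_nhds_in_open) auto
    hence "f has_fps_expansion Abs_fps (\<lambda>n. of_rat (B n) / fact n)"
      by (intro has_fps_expansionI, elim eventually_mono)
         (use that in \<open>auto simp: is_bernoulli_seq_def f_def\<close>)
    from fps_expansion_unique_complex[OF this f] show ?thesis
      by (auto simp: fps_eq_iff)
  qed
  show ?thesis
  proof (rule ex_ex1I)
    fix B C
    assume "is_bernoulli_seq B" "is_bernoulli_seq C"
    hence "of_rat (B n) / fact n = (of_rat (C n) / fact n :: complex)" for n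
      by (simp add: uniq)
    thus "B = C"
      by (auto simp: fun_eq_iff)
  qed (use ex in blast)
qed

lemma is_bernoulli_seq_bernoulli: "is_bernoulli_seq bernoulli"
  unfolding bernoulli_def by (rule theI'[OF is_bernoulli_seq_ex1])

end

theory Submission
  imports Defs "HOL-Number_Theory.Cong"
begin

text \<open>
  For even \<open>n > 2\<close> the Bernoulli number vanishes, and pairing \<open>k\<close> with \<open>n - k\<close> leaves only the
  middle term \<open>(n/2)\<^sup>n\<^sup>-\<^sup>1\<close>. For odd \<open>n\<close>, Faulhaber's formula reads
  \[ S_N(n) = n B_N + n \sum_{j<N} \binom{N}{j} (n B_j) \frac{n^{N-1-j}}{N+1-j}. \]
  As \<open>n\<close> has no prime factor 2, the fractions \<open>n\<^sup>i\<^sup>-\<^sup>2 / i\<close> with \<open>i \<ge> 2\<close> have denominators coprime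
  to \<open>n\<close>. So by induction every \<open>n B\<^sub>j\<close> has such a denominator (a weak form of von Staudt--Clausen),
  and the formula then gives \<open>S\<^sub>N(n) \<equiv> n B\<^sub>N\<close> modulo \<open>n\<close>.
\<close>

section \<open>Generating function identities\<close>

definition bernoulli_egf :: "rat fps" where
  "bernoulli_egf = Abs_fps (\<lambda>n. bernoulli n / fact n)"

text \<open>The solutions of exp z = 1 are the multiples of 2 pi i, and the nonzero ones have norm
  at least 2 pi. This keeps the denominator of the generating function nonzero near 0.\<close>

lemma exp_neq_1:
  fixes z :: complex
  assumes "z \<noteq> 0" "norm z < 2 * pi"
  shows "exp z \<noteq> 1"
proof
  assume "exp z = 1"
  then obtain k :: int where k: "Re z = 0" "Im z = of_int (2 * k) * pi"
    by (auto simp: exp_eq_1)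
  have "k \<noteq> 0"
    using k assms by (auto simp: complex_eq_iff)
  then have "of_int \<bar>k\<bar> \<ge> (1::real)"
    by linarith
  moreover have "norm z = 2 * pi * of_int \<bar>k\<bar>"
    using k by (simp add: cmod_def abs_mult)
  ultimately show False
    using assms by simp
qed

lemma of_rat_fact: "of_rat (fact n) = (fact n :: 'a :: field_char_0)"
  by (metis of_nat_fact of_rat_of_nat_eq)

text \<open>Turns the analytic definition into a formal identity, the only property of
  \<open>bernoulli\<close> used from here on. It holds over the complex numbers by uniqueness of
  power series expansions at 0, and descends to the rationals because \<open>of_rat\<close> is
  injective.\<close>

lemma bernoulli_egf_mult_exp: "bernoulli_egf * (fps_exp 1 - 1) = fps_X"
proof (rule fps_ext)
  fix n
  define F :: "complex fps" where "F = Abs_fps (\<lambda>n. of_rat (bernoulli n) / fact n)"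
  define f :: "complex \<Rightarrow> complex" where "f = (\<lambda>z. if z = 0 then 1 else z / (exp z - 1))"
  have near: "eventually (\<lambda>z::complex. z \<in> ball 0 (2 * pi)) (nhds 0)"
    by (intro eventually_nhds_in_open) auto
  have "f has_fps_expansion F"
    unfolding F_def
    by (intro has_fps_expansionI eventually_mono[OF near])
       (use is_bernoulli_seq_bernoulli in \<open>auto simp: is_bernoulli_seq_def f_def\<close>)
  then have "(\<lambda>z. f z * (exp z - 1)) has_fps_expansion F * (fps_exp 1 - 1)"
    by (intro has_fps_expansion_mult has_fps_expansion_diff has_fps_expansion_exp1
          has_fps_expansion_1)
  moreover have "eventually (\<lambda>z. f z * (exp z - 1) = z) (nhds 0)"
    by (intro eventually_mono[OF near]) (auto simp: f_def dest: exp_neq_1)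
  ultimately have "(\<lambda>z. z) has_fps_expansion F * (fps_exp 1 - 1)"
    by (subst (asm) has_fps_expansion_cong) auto
  then have "F * (fps_exp 1 - 1) = fps_X"
    using fps_expansion_unique_complex has_fps_expansion_fps_X by blast
  \<comment> \<open>\<open>of_rat\<close> is a ring homomorphism, so it commutes with Cauchy
    products.\<close>
  moreover have "of_rat (fps_nth (bernoulli_egf * (fps_exp 1 - 1)) n)
      = fps_nth (F * (fps_exp 1 - 1)) n"
    by (auto simp: fps_mult_nth of_rat_sum of_rat_mult of_rat_diff of_rat_divide of_rat_fact
        bernoulli_egf_def F_def simp del: fact_Suc intro!: sum.cong)
  ultimately have "of_rat (fps_nth (bernoulli_egf * (fps_exp 1 - 1)) n)
      = (of_rat (fps_nth fps_X n) :: complex)"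
    by simp
  then show "fps_nth (bernoulli_egf * (fps_exp 1 - 1)) n = fps_nth fps_X n"
    by (simp only: of_rat_eq_iff)
qed

text \<open>Writing B(X) for the generating function, substituting -X gives B(-X) = B(X) + X. At an
  odd index above 1 the coefficient therefore equals its own negative.\<close>

lemma bernoulli_odd_eq_0:
  assumes "odd n" "n > 1"
  shows "bernoulli n = 0"
proof -
  define E :: "rat fps" where "E = fps_exp 1"
  define F' where "F' = fps_compose bernoulli_egf (- fps_X)"
  have "fps_exp (-1) * E = (1 :: rat fps)"
    unfolding E_def by (metis add.left_inverse fps_exp_0 fps_exp_add_mult)
  have "fps_compose (bernoulli_egf * (E - 1)) (- fps_X) = fps_compose fps_X (- fps_X)"
    by (simp add: bernoulli_egf_mult_exp E_def)
  then have "F' * (fps_exp (-1) - 1) = - fps_X"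
    by (simp add: fps_compose_mult_distrib fps_compose_sub_distrib F'_def E_def)
  \<comment> \<open>Multiplying by \<open>E\<close> turns \<open>fps_exp (-1) - 1\<close> into
    \<open>1 - E\<close>.\<close>
  have "F' * (E - 1) = - (F' * (fps_exp (-1) - 1) * E)"
    using \<open>fps_exp (-1) * E = 1\<close>
    by (simp add: left_diff_distrib right_diff_distrib mult.assoc)
  also have "\<dots> = fps_X * E"
    using \<open>F' * (fps_exp (-1) - 1) = - fps_X\<close> by simp
  also have "\<dots> = (bernoulli_egf + fps_X) * (E - 1)"
    using bernoulli_egf_mult_exp by (simp add: E_def algebra_simps)
  finally have "F' * (E - 1) = (bernoulli_egf + fps_X) * (E - 1)" .
  moreover have "fps_nth (E - 1) 1 \<noteq> 0"
    by (simp add: E_def)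
  then have "E - 1 \<noteq> 0"
    by auto
  ultimately have "F' = bernoulli_egf + fps_X"
    by simp
  then have "fps_nth F' n = fps_nth (bernoulli_egf + fps_X) n"
    by simp
  then show ?thesis
    using assms by (simp add: F'_def bernoulli_egf_def fps_compose_uminus')
qed

text \<open>The powers of \<open>E\<close> form a geometric sum, and multiplying it by
  \<open>E - 1\<close> telescopes. The formula compares coefficients at index \<open>Suc N\<close>.
  For \<open>N = 0\<close> the term at \<open>k = 0\<close> counts as 1.\<close>

lemma faulhaber:
  "(\<Sum>k<m. of_nat k ^ N) =
    (\<Sum>j\<le>N. of_nat (N choose j) * bernoulli j * of_nat m ^ (Suc N - j) / of_nat (Suc N - j))"
proof -
  define E :: "rat fps" where "E = fps_exp 1"
  have pow: "E ^ k = fps_exp (of_nat k)" for k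
    by (simp add: E_def fps_exp_power_mult)
  have "fps_X * (\<Sum>k<m. E ^ k) = bernoulli_egf * ((E - 1) * (\<Sum>k<m. E ^ k))"
    using bernoulli_egf_mult_exp by (simp add: E_def mult.assoc[symmetric])
  also have "\<dots> = bernoulli_egf * (fps_exp (of_nat m) - 1)"
    unfolding power_diff_1_eq[symmetric] unfolding pow ..
  finally have "fps_X * (\<Sum>k<m. E ^ k) = bernoulli_egf * (fps_exp (of_nat m) - 1)" .
  moreover have "fps_nth (fps_X * (\<Sum>k<m. E ^ k)) (Suc N) = (\<Sum>k<m. of_nat k ^ N / fact N)"
    by (simp add: fps_sum_nth pow)
  moreover have "fps_nth (bernoulli_egf * (fps_exp (of_nat m) - 1)) (Suc N)
      = (\<Sum>j\<le>N. bernoulli j / fact j * (of_nat m ^ (Suc N - j) / fact (Suc N - j)))"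
    by (auto simp: fps_mult_nth bernoulli_egf_def atLeast0AtMost simp del: fact_Suc intro!: sum.cong)
  ultimately have "(\<Sum>k<m. of_nat k ^ N) = fact N *
      (\<Sum>j\<le>N. bernoulli j / fact j * (of_nat m ^ (Suc N - j) / fact (Suc N - j)))"
    by (simp add: sum_divide_distrib[symmetric] divide_eq_eq mult.commute[of "fact N"]
        del: fact_Suc)
  also have "\<dots> = (\<Sum>j\<le>N. of_nat (N choose j) * bernoulli j * of_nat m ^ (Suc N - j)
      / of_nat (Suc N - j))"
    unfolding sum_distrib_left
  proof (rule sum.cong[OF refl])
    fix j assume "j \<in> {..N}"
    then have "Suc N - j = Suc (N - j)" "j \<le> N" by auto
    then show "fact N * (bernoulli j / fact j * (of_nat m ^ (Suc N - j) / fact (Suc N - j)))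
        = of_nat (N choose j) * bernoulli j * of_nat m ^ (Suc N - j) / of_nat (Suc N - j)"
      by (simp add: binomial_fact mult_ac)
  qed
  finally show ?thesis .
qed

text \<open>Isolates the term \<open>j = N\<close> and attaches one factor \<open>m\<close> to each
  remaining Bernoulli number, since the products \<open>m * bernoulli j\<close> are what the later
  induction controls. For \<open>j < N\<close> the exponent \<open>Suc N - j - 2\<close> is not
  truncated.\<close>

lemma faulhaber_split:
  "(\<Sum>k<m. of_nat k ^ N) = of_nat m * bernoulli N + of_nat m *
    (\<Sum>j<N. of_nat (N choose j) * (of_nat m * bernoulli j) *
      (of_nat m ^ (Suc N - j - 2) / of_nat (Suc N - j)))"
proof -
  have "of_nat (N choose j) * bernoulli j * of_nat m ^ (Suc N - j) / of_nat (Suc N - j)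
     = of_nat m * (of_nat (N choose j) * (of_nat m * bernoulli j) *
      (of_nat m ^ (Suc N - j - 2) / of_nat (Suc N - j)))" if "j < N" for j
  proof -
    obtain d where "N = Suc (j + d)"
      using \<open>j < N\<close> less_imp_Suc_add by blast
    then have "Suc N - j = Suc (Suc d)"
      by simp
    then show ?thesis
      by simp
  qed
  then have "(\<Sum>j<N. of_nat (N choose j) * bernoulli j * of_nat m ^ (Suc N - j)
      / of_nat (Suc N - j))
    = of_nat m * (\<Sum>j<N. of_nat (N choose j) * (of_nat m * bernoulli j) *
        (of_nat m ^ (Suc N - j - 2) / of_nat (Suc N - j)))"
    unfolding sum_distrib_left by (intro sum.cong[OF refl]) (simp only: lessThan_iff)
  moreover have "of_nat (N choose N) * bernoulli N * of_nat m ^ (Suc N - N) / of_nat (Suc N - N)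
    = of_nat m * bernoulli N"
    by simp
  ultimately show ?thesis
    unfolding faulhaber lessThan_Suc_atMost[symmetric] sum.lessThan_Suc
    by (simp only: add.commute)
qed

section \<open>Rational numbers with denominator coprime to n\<close>

text \<open>This is the localization of the integers at the primes dividing \<open>n\<close>. The
  denominator \<open>q\<close> need not be the reduced one, which makes closure under sums and
  products immediate. As 0 is coprime to 1, \<open>q = 0\<close> has to be excluded
  explicitly.\<close>

definition integral_at :: "nat \<Rightarrow> rat \<Rightarrow> bool" where
  "integral_at n x \<longleftrightarrow> (\<exists>q::int. q \<noteq> 0 \<and> coprime q (int n) \<and> of_int q * x \<in> \<int>)"

lemma integral_at_Ints: "x \<in> \<int> \<Longrightarrow> integral_at n x"
  unfolding integral_at_def by (rule exI[of _ 1]) auto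

lemma integral_at_add:
  assumes "integral_at n x" "integral_at n y"
  shows "integral_at n (x + y)"
proof -
  from assms obtain q r :: int where
    q: "q \<noteq> 0" "coprime q (int n)" "of_int q * x \<in> \<int>" and
    r: "r \<noteq> 0" "coprime r (int n)" "of_int r * y \<in> \<int>"
    unfolding integral_at_def by blast
  have "of_int (q * r) * (x + y) = of_int r * (of_int q * x) + of_int q * (of_int r * y)"
    by (simp add: algebra_simps)
  also have "\<dots> \<in> \<int>"
    using q r by (intro Ints_add Ints_mult[OF _ q(3)] Ints_mult[OF _ r(3)]) auto
  finally show ?thesis
    unfolding integral_at_def using q r by (intro exI[of _ "q * r"]) auto
qed

lemma integral_at_mult:
  assumes "integral_at n x" "integral_at n y"
  shows "integral_at n (x * y)"
proof -
  from assms obtain q r :: int where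
    q: "q \<noteq> 0" "coprime q (int n)" "of_int q * x \<in> \<int>" and
    r: "r \<noteq> 0" "coprime r (int n)" "of_int r * y \<in> \<int>"
    unfolding integral_at_def by blast
  have "of_int (q * r) * (x * y) = (of_int q * x) * (of_int r * y)"
    by simp
  also have "\<dots> \<in> \<int>"
    using q(3) r(3) by (rule Ints_mult)
  finally show ?thesis
    unfolding integral_at_def using q r by (intro exI[of _ "q * r"]) auto
qed

lemma integral_at_diff:
  assumes "integral_at n x" "integral_at n y"
  shows "integral_at n (x - y)"
  using integral_at_add[OF assms(1) integral_at_mult[OF integral_at_Ints[of "-1"] assms(2)]]
  by simp

lemma integral_at_sum:
  "(\<And>i. i \<in> A \<Longrightarrow> integral_at n (f i)) \<Longrightarrow> integral_at n (sum f A)"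
  by (induction A rule: infinite_finite_induct) (auto intro: integral_at_add integral_at_Ints)

lemma rat_congI:
  assumes "a - b = of_nat n * x" "integral_at n x"
  shows "rat_cong a b n"
proof -
  obtain p d where pd: "quotient_of (a - b) = (p, d)"
    by fastforce
  then have "d > 0" "coprime p d" and ab: "a - b = of_int p / of_int d"
    using quotient_of_denom_pos quotient_of_coprime quotient_of_div by blast+
  from assms(2) obtain q c :: int where
    q: "q \<noteq> 0" "coprime q (int n)" and c: "of_int q * x = of_int c"
    unfolding integral_at_def by (auto elim: Ints_cases)
  have "of_int (q * p) = (of_int q * (a - b)) * of_int d"
    using ab \<open>d > 0\<close> by simp
  also have "\<dots> = of_int (int n * c * d)"
    unfolding assms(1) using c by simp
  finally have eq: "q * p = int n * c * d"
    by (simp only: of_int_eq_iff)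
  \<comment> \<open>The reduced denominator divides any other one, so it inherits coprimality to
    \<open>n\<close>.\<close>
  then have "d dvd q"
    using \<open>coprime p d\<close> by (metis coprime_commute coprime_dvd_mult_left_iff dvd_triv_right)
  then have "coprime d (int n)"
    using q by (metis coprime_divisors dvd_refl)
  moreover have "int n dvd q * p"
    using eq by simp
  then have "int n dvd p"
    using q by (simp add: coprime_commute coprime_dvd_mult_right_iff)
  ultimately show ?thesis
    by (simp add: rat_cong_def pd)
qed

text \<open>Divide \<open>i\<close> repeatedly by its gcd with \<open>n\<close> until the rest
  \<open>b\<close> is coprime to \<open>n\<close>. Each gcd is odd and not 1, hence at least 3,
  which bounds the number \<open>e\<close> of divisions by 3^e \<le> i.\<close>

lemma odd_coprime_part:
  fixes n i :: nat
  assumes "odd n" "i > 0"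
  shows "\<exists>b e. b > 0 \<and> coprime b n \<and> 3 ^ e \<le> i \<and> i dvd b * n ^ e"
  using assms(2)
proof (induction i rule: less_induct)
  case (less i)
  show ?case
  proof (cases "coprime i n")
    case True
    then show ?thesis
      using less.prems by (intro exI[of _ i] exI[of _ 0]) auto
  next
    case False
    define d where "d = gcd i n"
    have "odd d"
      using assms(1) unfolding d_def by (meson dvd_trans gcd_dvd2)
    moreover have "d \<noteq> 1"
      using False by (simp add: d_def coprime_iff_gcd_eq_1)
    ultimately have "d \<ge> 3"
      by presburger
    obtain i' where i': "i = d * i'"
      unfolding d_def by (meson dvdE gcd_dvd1)
    with less.prems \<open>d \<ge> 3\<close> have "i' > 0" "i' < i"
      by auto
    then obtain b e where b: "b > 0" "coprime b n" "3 ^ e \<le> i'" "i' dvd b * n ^ e"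
      using less.IH by blast
    have "d * i' dvd n * (b * n ^ e)"
      using b by (intro mult_dvd_mono) (auto simp: d_def)
    then have "i dvd b * n ^ Suc e"
      by (simp add: i' mult_ac)
    moreover have "3 ^ Suc e \<le> i"
      using mult_le_mono[OF \<open>d \<ge> 3\<close> b(3)] by (simp add: i')
    ultimately show ?thesis
      using b by blast
  qed
qed

text \<open>Since i < 3^(i-1) for i \<ge> 2, the exponent \<open>e\<close> of the previous lemma is
  at most \<open>i - 2\<close>, so this power of \<open>n\<close> absorbs everything in
  \<open>i\<close> that is not coprime to \<open>n\<close>. For even \<open>n\<close> this already
  fails at \<open>i = 2\<close>.\<close>

lemma integral_at_power_div:
  assumes "odd n" "i \<ge> 2"
  shows "integral_at n (of_nat n ^ (i - 2) / of_nat i)"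
proof -
  obtain b e where b: "b > 0" "coprime b n" "3 ^ e \<le> i" "i dvd b * n ^ e"
    using odd_coprime_part[OF assms(1), of i] assms(2) by auto
  have growth: "Suc (Suc k) < 3 ^ Suc k" for k :: nat
    by (induction k) auto
  have "e \<le> i - 2"
  proof (rule ccontr)
    assume "\<not> e \<le> i - 2"
    then have "(3::nat) ^ Suc (i - 2) \<le> 3 ^ e"
      by (intro power_increasing) auto
    with b(3) growth[of "i - 2"] assms(2) show False
      by simp
  qed
  then have "i dvd b * n ^ (i - 2)"
    using b(4) by (meson dvd_trans le_imp_power_dvd mult_dvd_mono dvd_refl)
  then obtain c where "b * n ^ (i - 2) = i * c"
    by blast
  then have "of_nat b * of_nat n ^ (i - 2) = (of_nat i * of_nat c :: rat)"
    by (metis of_nat_mult of_nat_power)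
  then have "of_int (int b) * (of_nat n ^ (i - 2) / of_nat i) = (of_nat c :: rat)"
    using assms(2) by (simp add: field_simps)
  then show ?thesis
    unfolding integral_at_def using b by (intro exI[of _ "int b"]) auto
qed

section \<open>The two parities\<close>

lemma power_sum_eq:
  "N > 0 \<Longrightarrow> of_nat (power_sum N m) = (\<Sum>k<m. of_nat k ^ N :: 'a :: comm_semiring_1)"
  unfolding power_sum_def of_nat_sum of_nat_power
  by (intro sum.mono_neutral_left) (auto simp: zero_power Suc_le_eq not_le)

text \<open>Strong induction: Faulhaber's formula is solved for its leading term, and the rest
  involves only \<open>of_nat n * bernoulli j\<close> with \<open>j < N\<close>.\<close>

lemma integral_at_mult_bernoulli:
  assumes "odd n"
  shows "integral_at n (of_nat n * bernoulli N)"
proof (induction N rule: less_induct)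
  case (less N)
  have "of_nat n * bernoulli N = (\<Sum>k<n. of_nat k ^ N) - of_nat n *
    (\<Sum>j<N. of_nat (N choose j) * (of_nat n * bernoulli j) *
      (of_nat n ^ (Suc N - j - 2) / of_nat (Suc N - j)))"
    using faulhaber_split[of N n] by simp
  also have "integral_at n \<dots>"
    by (intro integral_at_diff integral_at_mult integral_at_sum integral_at_power_div
          integral_at_Ints[of "of_nat _"] integral_at_Ints[of "of_nat _ ^ _"] less.IH assms) auto
  finally show ?case .
qed

lemma power_sum_cong_odd:
  assumes "odd n" "N > 0"
  shows "rat_cong (of_nat (power_sum N n) - of_nat n * bernoulli N) 0 n"
proof (rule rat_congI)
  show "of_nat (power_sum N n) - of_nat n * bernoulli N - 0 = of_nat n *
    (\<Sum>j<N. of_nat (N choose j) * (of_nat n * bernoulli j) *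
      (of_nat n ^ (Suc N - j - 2) / of_nat (Suc N - j)))"
    using faulhaber_split[of N n] assms(2) by (simp add: power_sum_eq)
  show "integral_at n (\<Sum>j<N. of_nat (N choose j) * (of_nat n * bernoulli j) *
      (of_nat n ^ (Suc N - j - 2) / of_nat (Suc N - j)))"
    by (intro integral_at_mult integral_at_sum integral_at_power_div
          integral_at_Ints[of "of_nat _"] integral_at_mult_bernoulli assms) auto
qed

text \<open>For odd \<open>N\<close> the terms at k and 2h - k cancel modulo 2h.\<close>

lemma power_sum_cong_middle:
  assumes "odd N" "h > 0"
  shows "[int (power_sum N (2 * h)) = int h ^ N] (mod int (2 * h))"
proof -
  have split: "{1..2 * h - 1} = {1..<h} \<union> {h} \<union> {h<..<2 * h}"
    using assms(2) by auto
  have "int (power_sum N (2 * h)) = (\<Sum>k\<in>{1..<h} \<union> {h} \<union> {h<..<2 * h}. int k ^ N)"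
    unfolding power_sum_def split of_nat_sum of_nat_power ..
  also have "\<dots> = (\<Sum>k\<in>{1..<h}. int k ^ N) + int h ^ N + (\<Sum>k\<in>{h<..<2 * h}. int k ^ N)"
    by (subst sum.union_disjoint; (subst sum.union_disjoint)?) auto
  \<comment> \<open>The reflection k -> 2h - k maps the upper half onto the lower half.\<close>
  also have "(\<Sum>k\<in>{h<..<2 * h}. int k ^ N) = (\<Sum>k\<in>{1..<h}. (int (2 * h) - int k) ^ N)"
    by (intro sum.reindex_bij_witness[of _ "\<lambda>k. 2 * h - k" "\<lambda>k. 2 * h - k"])
       (auto simp: of_nat_diff)
  finally have "int (power_sum N (2 * h)) - int h ^ N
      = (\<Sum>k\<in>{1..<h}. int k ^ N + (int (2 * h) - int k) ^ N)"
    by (simp add: sum.distrib)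
  also have "int (2 * h) dvd \<dots>"
  proof (rule dvd_sum)
    fix k
    have "[int (2 * h) - int k = - int k] (mod int (2 * h))"
      by (simp add: cong_iff_dvd_diff)
    then have "[(int (2 * h) - int k) ^ N = (- int k) ^ N] (mod int (2 * h))"
      by (rule cong_pow)
    then show "int (2 * h) dvd int k ^ N + (int (2 * h) - int k) ^ N"
      using assms(1) by (simp add: cong_iff_dvd_diff add.commute)
  qed
  finally show ?thesis
    by (simp add: cong_iff_dvd_diff)
qed

lemma half_power_cong:
  assumes "odd N" "N > 1"
  shows "[int h ^ N = (if odd h then int h else 0)] (mod int (2 * h))"
proof -
  obtain M where N: "N = Suc (Suc M)"
    by (rule that[of "N - 2"]) (use assms(2) in simp)
  \<comment> \<open>The second factor is even, because the positive power
    \<open>int h ^ Suc M\<close> has the parity of \<open>h\<close>.\<close>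
  have "int (2 * h) dvd int h * (int h ^ Suc M - (if odd h then 1 else 0))"
    unfolding of_nat_mult mult.commute[of "int 2"]
    by (intro mult_dvd_mono) auto
  then show ?thesis
    by (simp add: N cong_iff_dvd_diff algebra_simps split: if_splits)
qed

theorem theorem2p3:
  fixes n :: nat
  assumes "n \<ge> 2"
  shows "rat_cong (of_nat (power_sum (n - 1) n) - of_nat n * bernoulli (n - 1))
           (if n mod 4 = 2 \<and> n > 2 then of_nat n / 2 else 0) n"
proof -
  consider "odd n" | "n = 2" | "even n" "n > 2"
    using assms by linarith
  then show ?thesis
  proof cases
    case 1
    then have "n mod 4 \<noteq> 2"
      by presburger
    then show ?thesis
      using power_sum_cong_odd[OF 1, of "n - 1"] assms by simp
  next
    case 2
    \<comment> \<open>With \<open>m = 1\<close> the power sum is just 0^N, so the formula gives B_0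
      = 1 and then 0 = B_0/2 + B_1. The left side of the claim is thus 1 + 1 = 2 * 1, whence the
      witness 1 below.\<close>
    have "bernoulli 0 = 1" "bernoulli 1 = - 1 / 2"
      using faulhaber[of 0 1] faulhaber[of 1 1] by auto
    moreover have "power_sum 1 2 = 1"
      by (simp add: power_sum_def)
    ultimately show ?thesis
      unfolding 2 by (intro rat_congI[of _ _ _ 1] integral_at_Ints) auto
  next
    case 3
    define h where "h = n div 2"
    have n: "n = 2 * h" and h: "h > 1"
      using 3 by (auto simp: h_def)
    have odd: "odd (n - 1)" "n - 1 > 1"
      using 3 by auto
    have "[int (power_sum (n - 1) n) = (if odd h then int h else 0)] (mod int n)"
      using power_sum_cong_middle[OF odd(1)] half_power_cong[OF odd] h
      unfolding n by (meson cong_trans less_trans zero_less_one)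
    then obtain c where c: "int (power_sum (n - 1) n) - (if odd h then int h else 0) = int n * c"
      by (auto simp: cong_iff_dvd_diff)
    have "(n mod 4 = 2 \<and> n > 2) = odd h"
      using h unfolding n by presburger
    \<comment> \<open>The rational n/2 is the integer \<open>h\<close>, so the integer congruence
      carries over; the Bernoulli term vanishes at the odd index \<open>n - 1\<close>.\<close>
    moreover have "of_nat (power_sum (n - 1) n) - (if odd h then of_nat n / 2 else 0)
        = (of_int (int (power_sum (n - 1) n) - (if odd h then int h else 0)) :: rat)"
      by (simp add: n)
    ultimately show ?thesis
      unfolding c using bernoulli_odd_eq_0[OF odd]
      by (intro rat_congI[of _ _ _ "of_int c"] integral_at_Ints) auto
  qed
qed

end
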